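(* Let $\mathcal M=(\mathbf M^{(\lambda)})_{\lambda>0}$ be a weight matrix on $\mathbb N_0^d$ such that for every $\lambda>0$ there exist $\kappa\ge\lambda$ and $A\ge1$ with $M^{(\lambda)}_{\alpha+e_j}\le A^{|\alpha|+1}M^{(\kappa)}_\alpha$ for all $\alpha\in\mathbb N_0^d$ and $1\le j\le d$. Then the sequence space $\Lambda_{\{\mathcal M\}}$ is nuclear.
   Context: A weight matrix is a family $\mathcal M=(\mathbf M^{(\lambda)})_{\lambda>0}$ with $\mathbf M^{(\lambda)}=(M^{(\lambda)}_\alpha)_{\alpha\in\mathbb N_0^d}$ sequences of positive reals, $M^{(\lambda)}_0=1$, and $M^{(\lambda)}_\alpha\le M^{(\kappa)}_\alpha$ for all $\alpha$ whenever $0<\lambda\le\kappa$. $e_j$ denotes the $j$-th unit vector, $|\alpha|=\sum\alpha_j$. The associated weight function of $\mathbf M=(M_\alpha)$ is $\omega_{\mathbf M}(t)=\sup_{\alpha\in\mathbb N^d_{0,t}}\log\frac{|t^\alpha|}{M_\alpha}$ ($t\in\mathbb R^d$), where $\mathbb N^d_{0,t}=\{\alpha:\alpha_j=0\text{ whenever }t_j=0\}$ and $0^0:=1$. With $\alpha^{1/2}=(\alpha_1^{1/2},\dots,\alpha_d^{1/2})$ and $\|\mathbf c\|_{\mathbf M,h}:=\sup_\alpha|c_\alpha|e^{\omega_{\mathbf M}(\alpha^{1/2}/h)}$, $\Lambda_{\{\mathcal M\}}$ is the space of $\mathbf c\in\mathbb C^{\mathbb N_0^d}$ with $\|\mathbf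 c\|_{\mathbf M^{(\lambda)},h}<\infty$ for some $\lambda,h>0$, with the inductive limit topology of the normed spaces $\{\mathbf c:\|\mathbf c\|_{\mathbf M^{(j)},j}<\infty\}$, $j\in\mathbb N$. *)

theory Defs
  imports "HOL-Analysis.Analysis"
begin

text \<open>Multi-indices in N_0^d are functions 'd => nat for a finite index type 'd.\<close>

definition mlen :: "('d::finite \<Rightarrow> nat) \<Rightarrow> nat" where
  "mlen \<alpha> = (\<Sum>i\<in>UNIV. \<alpha> i)"

definition unitv :: "'d \<Rightarrow> ('d \<Rightarrow> nat)" where
  "unitv j = (\<lambda>i. if i = j then 1 else 0)"

definition weight_matrix :: "(real \<Rightarrow> ('d::finite \<Rightarrow> nat) \<Rightarrow> real) \<Rightarrow> bool" where
  "weight_matrix M \<longleftrightarrow>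
     (\<forall>l>0. \<forall>\<alpha>. M l \<alpha> > 0) \<and>
     (\<forall>l>0. M l (\<lambda>_. 0) = 1) \<and>
     (\<forall>l k \<alpha>. 0 < l \<and> l \<le> k \<longrightarrow> M l \<alpha> \<le> M k \<alpha>)"

text \<open>Associated weight function (values in the extended reals; note 0^0 = 1).\<close>
definition omega_M :: "(('d::finite \<Rightarrow> nat) \<Rightarrow> real) \<Rightarrow> ('d \<Rightarrow> real) \<Rightarrow> ereal" where
  "omega_M M t = (SUP \<alpha>\<in>{\<alpha>. \<forall>j. t j = 0 \<longrightarrow> \<alpha> j = 0}.
                    ereal (ln (\<bar>\<Prod>j\<in>UNIV. t j ^ \<alpha> j\<bar> / M \<alpha>)))"

definition exp_ereal :: "ereal \<Rightarrow> ereal" where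
  "exp_ereal x = (case x of ereal r \<Rightarrow> ereal (exp r) | PInfty \<Rightarrow> PInfty | MInfty \<Rightarrow> 0)"

definition seqnorm :: "(('d::finite \<Rightarrow> nat) \<Rightarrow> real) \<Rightarrow> real \<Rightarrow> (('d \<Rightarrow> nat) \<Rightarrow> complex) \<Rightarrow> ereal" where
  "seqnorm M h c = (SUP \<alpha>. ereal (cmod (c \<alpha>)) *
                       exp_ereal (omega_M M (\<lambda>j. sqrt (real (\<alpha> j)) / h)))"

definition Lambda_M :: "(real \<Rightarrow> ('d::finite \<Rightarrow> nat) \<Rightarrow> real) \<Rightarrow> (('d \<Rightarrow> nat) \<Rightarrow> complex) set" where
  "Lambda_M M = {c. \<exists>l>0. \<exists>h>0. seqnorm (M l) h c < \<infinity>}"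

text \<open>Step spaces of the inductive limit, j = 1,2,...\<close>
definition step_space :: "(real \<Rightarrow> ('d::finite \<Rightarrow> nat) \<Rightarrow> real) \<Rightarrow> nat \<Rightarrow> (('d \<Rightarrow> nat) \<Rightarrow> complex) set" where
  "step_space M j = {c. seqnorm (M (real j)) (real j) c < \<infinity>}"

definition seminorm_on :: "('i \<Rightarrow> complex) set \<Rightarrow> (('i \<Rightarrow> complex) \<Rightarrow> real) \<Rightarrow> bool" where
  "seminorm_on E p \<longleftrightarrow>
     (\<forall>x\<in>E. 0 \<le> p x) \<and>
     (\<forall>x\<in>E. \<forall>y\<in>E. p (\<lambda>i. x i + y i) \<le> p x + p y) \<and>
     (\<forall>x\<in>E. \<forall>a. p (\<lambda>i. a * x i) = cmod a * p x)"

definition linear_functional_on :: "('i \<Rightarrow> complex) set \<Rightarrow> (('i \<Rightarrow> complex) \<Rightarrow> complex) \<Rightarrow> bool" where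
  "linear_functional_on E u \<longleftrightarrow>
     (\<forall>x\<in>E. \<forall>y\<in>E. u (\<lambda>i. x i + y i) = u x + u y) \<and>
     (\<forall>x\<in>E. \<forall>a. u (\<lambda>i. a * x i) = a * u x)"

text \<open>Continuous seminorms for the locally convex inductive limit topology of the
  normed step spaces: exactly those seminorms whose restriction to every step space
  is bounded by a multiple of the step norm.\<close>
definition cont_seminorm_Lambda ::
  "(real \<Rightarrow> ('d::finite \<Rightarrow> nat) \<Rightarrow> real) \<Rightarrow> ((('d \<Rightarrow> nat) \<Rightarrow> complex) \<Rightarrow> real) \<Rightarrow> bool" where
  "cont_seminorm_Lambda M p \<longleftrightarrow>
     seminorm_on (Lambda_M M) p \<and>
     (\<forall>j\<ge>1. \<exists>C. \<forall>c\<in>step_space M j. p c \<le> C * real_of_ereal (seqnorm (M (real j)) (real j) c))"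

text \<open>The canonical map E_q -> (completion of) E_p is nuclear: it has a representation
  x |-> sum_n u_n(x) y_n with u_n linear, |u_n| <= c_n q, sum c_n < infinity, p(y_n) <= 1.\<close>
definition nuclear_canonical ::
  "('i \<Rightarrow> complex) set \<Rightarrow> (('i \<Rightarrow> complex) \<Rightarrow> real) \<Rightarrow> (('i \<Rightarrow> complex) \<Rightarrow> real) \<Rightarrow> bool" where
  "nuclear_canonical E p q \<longleftrightarrow>
     (\<exists>u y c. (\<forall>n. linear_functional_on E (u n)) \<and>
              (\<forall>n. 0 \<le> c n) \<and> summable c \<and>
              (\<forall>n. \<forall>x\<in>E. cmod (u n x) \<le> c n * q x) \<and>
              (\<forall>n. y n \<in> E \<and> p (y n) \<le> 1) \<and>
              (\<forall>x\<in>E. (\<lambda>N. p (\<lambda>i. x i - (\<Sum>n<N. u n x * y n i))) \<longlonglongrightarrow> 0))"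

text \<open>A locally convex space (E with its family P of continuous seminorms) is nuclear.\<close>
definition nuclear_lcs ::
  "('i \<Rightarrow> complex) set \<Rightarrow> ((('i \<Rightarrow> complex) \<Rightarrow> real) \<Rightarrow> bool) \<Rightarrow> bool" where
  "nuclear_lcs E P \<longleftrightarrow>
     (\<forall>p. P p \<longrightarrow> (\<exists>q. P q \<and> (\<forall>x\<in>E. p x \<le> q x) \<and> nuclear_canonical E p q))"

end

theory Submission
  imports Defs
begin

text \<open>The hypothesis on \<open>M\<close> says that multiplication by \<open>sqrt (1 + \<alpha>\<^sub>j)\<close> maps every step space
  boundedly into a later one. Iterating, so does multiplication by \<open>1 / \<rho>\<close>, where
  \<open>\<rho> \<alpha> = (\<Prod>j. (1 + \<alpha>\<^sub>j)\<^sup>-\<^sup>2)\<close> is summable and does not depend on the step. Hence for a continuous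
  seminorm \<open>p\<close> the weighted \<open>\<ell>\<^sup>1\<close>-norm \<open>q x = (\<Sum>\<alpha>. \<bar>x \<alpha>\<bar> (1 + p \<delta>\<^sub>\<alpha>) / \<rho> \<alpha>)\<close> is again continuous,
  and the expansion \<open>x = (\<Sum>\<alpha>. x \<alpha> \<delta>\<^sub>\<alpha>)\<close> is a nuclear representation with coefficients \<open>\<rho> \<alpha>\<close>.\<close>

section \<open>Step norms as explicit inequalities\<close>

text \<open>For positive \<open>M\<close> and \<open>h\<close> this says \<open>seqnorm M h c \<le> B\<close> without suprema: the \<open>\<beta>\<close> excluded
  from the supremum in \<open>omega_M\<close> contribute a zero product.\<close>

definition dominated ::
  "(('d::finite \<Rightarrow> nat) \<Rightarrow> real) \<Rightarrow> real \<Rightarrow> real \<Rightarrow> (('d \<Rightarrow> nat) \<Rightarrow> complex) \<Rightarrow> bool" where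
  "dominated M h B c \<longleftrightarrow>
     (\<forall>\<alpha> \<beta>. cmod (c \<alpha>) * (\<Prod>i\<in>UNIV. (sqrt (real (\<alpha> i)) / h) ^ \<beta> i) \<le> B * M \<beta>)"

lemma exp_ereal_mono: "x \<le> y \<Longrightarrow> exp_ereal x \<le> exp_ereal y"
  by (cases x; cases y) (auto simp: exp_ereal_def)

lemma exp_ereal_nonneg: "0 \<le> exp_ereal x"
  by (cases x) (auto simp: exp_ereal_def)

lemma seqnorm_nonneg: "0 \<le> seqnorm M h c"
  unfolding seqnorm_def by (rule SUP_upper2[of undefined]) (auto simp: exp_ereal_nonneg)

text \<open>For \<open>\<beta>\<close> in \<open>S \<alpha>\<close> the monomial
  \<open>P \<alpha> \<beta>\<close> is positive, so \<open>exp\<close> undoes the \<open>ln\<close>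
  in \<open>omega_M\<close> and bounding the supremum amounts to bounding each quotient
  \<open>P \<alpha> \<beta> / M \<beta>\<close>.\<close>

lemma seqnorm_le_iff_dominated:
  fixes M :: "('d::finite \<Rightarrow> nat) \<Rightarrow> real"
  assumes h: "0 < h" and M: "\<And>\<beta>. 0 < M \<beta>" and B: "0 \<le> B"
  shows "seqnorm M h c \<le> ereal B \<longleftrightarrow> dominated M h B c"
proof -
  define P where "P \<alpha> \<beta> = (\<Prod>i\<in>UNIV. (sqrt (real (\<alpha> i)) / h) ^ \<beta> i)" for \<alpha> \<beta> :: "'d \<Rightarrow> nat"
  define W where "W \<alpha> = omega_M M (\<lambda>j. sqrt (real (\<alpha> j)) / h)" for \<alpha> :: "'d \<Rightarrow> nat"
  define S where "S \<alpha> = {\<beta> :: 'd \<Rightarrow> nat. \<forall>j. \<alpha> j = 0 \<longrightarrow> \<beta> j = 0}" for \<alpha> :: "'d \<Rightarrow> nat"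
  have P_pos: "0 < P \<alpha> \<beta>" if "\<beta> \<in> S \<alpha>" for \<alpha> \<beta> :: "'d \<Rightarrow> nat"
    unfolding P_def
  proof (rule prod_pos)
    fix i
    show "0 < (sqrt (real (\<alpha> i)) / h) ^ \<beta> i"
      using that h by (cases "\<alpha> i = 0") (auto simp: S_def)
  qed
  have P_zero: "P \<alpha> \<beta> = 0" if "\<beta> \<notin> S \<alpha>" for \<alpha> \<beta> :: "'d \<Rightarrow> nat"
    using that by (auto simp: S_def P_def)
  have W_eq: "W \<alpha> = (SUP \<beta>\<in>S \<alpha>. ereal (ln (P \<alpha> \<beta> / M \<beta>)))" for \<alpha>
    unfolding W_def omega_M_def
    using h P_pos[of _ \<alpha>] by (intro SUP_cong) (auto simp: S_def P_def less_imp_le)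
  have "(ereal (cmod (c \<alpha>)) * exp_ereal (W \<alpha>) \<le> ereal B) \<longleftrightarrow>
      (\<forall>\<beta>. cmod (c \<alpha>) * P \<alpha> \<beta> \<le> B * M \<beta>)" for \<alpha>
  proof
    assume le: "ereal (cmod (c \<alpha>)) * exp_ereal (W \<alpha>) \<le> ereal B"
    show "\<forall>\<beta>. cmod (c \<alpha>) * P \<alpha> \<beta> \<le> B * M \<beta>"
    proof
      fix \<beta>
      show "cmod (c \<alpha>) * P \<alpha> \<beta> \<le> B * M \<beta>"
      proof (cases "\<beta> \<in> S \<alpha>")
        case True
        have "exp_ereal (ereal (ln (P \<alpha> \<beta> / M \<beta>))) \<le> exp_ereal (W \<alpha>)"
          unfolding W_eq using True by (intro exp_ereal_mono SUP_upper)
        then have "ereal (P \<alpha> \<beta> / M \<beta>) \<le> exp_ereal (W \<alpha>)"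
          using P_pos[OF True] M[of \<beta>] by (simp add: exp_ereal_def)
        then have "ereal (cmod (c \<alpha>)) * ereal (P \<alpha> \<beta> / M \<beta>) \<le> ereal B"
          using le by (meson ereal_mult_left_mono norm_ge_zero ereal_less_eq(5) order_trans)
        then show ?thesis
          using M[of \<beta>] by (simp add: field_simps)
      next
        case False
        then show ?thesis
          using B M[of \<beta>] by (simp add: P_zero)
      qed
    qed
  next
    assume le: "\<forall>\<beta>. cmod (c \<alpha>) * P \<alpha> \<beta> \<le> B * M \<beta>"
    show "ereal (cmod (c \<alpha>)) * exp_ereal (W \<alpha>) \<le> ereal B"
    \<comment> \<open>\<open>W \<alpha>\<close> may be infinite; a vanishing coordinate is then
      harmless because zero times infinity is zero in the extended reals.\<close>
    proof (cases "c \<alpha> = 0")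
      case True
      then show ?thesis using B by (simp flip: zero_ereal_def)
    next
      case False
      then have r: "0 < cmod (c \<alpha>)" by simp
      \<comment> \<open>The index zero forces \<open>0 < B\<close>, without which
        \<open>ln (B / cmod (c \<alpha>))\<close> would not be a meaningful bound.\<close>
      have "P \<alpha> (\<lambda>_. 0) = 1" by (simp add: P_def)
      then have "0 < B * M (\<lambda>_. 0)" using le r by (metis less_le_trans mult.right_neutral)
      then have "0 < B" using M zero_less_mult_pos2 by blast
      have "W \<alpha> \<le> ereal (ln (B / cmod (c \<alpha>)))"
        unfolding W_eq
      proof (rule SUP_least)
        fix \<beta> assume "\<beta> \<in> S \<alpha>"
        then have "0 < P \<alpha> \<beta>" by (rule P_pos)
        then show "ereal (ln (P \<alpha> \<beta> / M \<beta>)) \<le> ereal (ln (B / cmod (c \<alpha>)))"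
          using le[rule_format, of \<beta>] r M[of \<beta>] \<open>0 < B\<close>
          by (simp add: divide_simps mult.commute)
      qed
      then have "exp_ereal (W \<alpha>) \<le> ereal (B / cmod (c \<alpha>))"
        using exp_ereal_mono[of "W \<alpha>" "ereal (ln (B / cmod (c \<alpha>)))"] r \<open>0 < B\<close>
        by (simp add: exp_ereal_def)
      then have "ereal (cmod (c \<alpha>)) * exp_ereal (W \<alpha>) \<le> ereal (cmod (c \<alpha>)) * ereal (B / cmod (c \<alpha>))"
        by (intro ereal_mult_left_mono) auto
      then show ?thesis using r by simp
    qed
  qed
  then show ?thesis
    unfolding seqnorm_def dominated_def SUP_le_iff W_def P_def by simp
qed

lemma dominated_cmod_le:
  assumes "dominated M h B c" and "0 < h" and "\<And>\<alpha>. cmod (c' \<alpha>) \<le> cmod (c \<alpha>)"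
  shows "dominated M h B c'"
  unfolding dominated_def
proof (intro allI)
  fix \<alpha> \<beta>
  have "cmod (c' \<alpha>) * (\<Prod>i\<in>UNIV. (sqrt (real (\<alpha> i)) / h) ^ \<beta> i)
      \<le> cmod (c \<alpha>) * (\<Prod>i\<in>UNIV. (sqrt (real (\<alpha> i)) / h) ^ \<beta> i)"
    using assms(2,3) by (intro mult_right_mono prod_nonneg) auto
  also have "\<dots> \<le> B * M \<beta>" using assms(1) by (auto simp: dominated_def)
  finally show "cmod (c' \<alpha>) * (\<Prod>i\<in>UNIV. (sqrt (real (\<alpha> i)) / h) ^ \<beta> i) \<le> B * M \<beta>" .
qed

lemma dominated_scale:
  assumes "dominated M h B c" and "0 \<le> r"
  shows "dominated M h (r * B) (\<lambda>\<alpha>. of_real r * c \<alpha>)"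
  unfolding dominated_def
proof (intro allI)
  fix \<alpha> \<beta>
  show "cmod (of_real r * c \<alpha>) * (\<Prod>i\<in>UNIV. (sqrt (real (\<alpha> i)) / h) ^ \<beta> i) \<le> r * B * M \<beta>"
    using mult_left_mono[OF assms(1)[unfolded dominated_def, rule_format, of \<alpha> \<beta>] assms(2)] assms(2)
    by (simp add: norm_mult mult.assoc)
qed

lemma dominated_mono:
  assumes "dominated M h B c" and "0 < h" and "h \<le> h'" and "\<And>\<beta>. M \<beta> \<le> M' \<beta>"
    and "0 \<le> B"
  shows "dominated M' h' B c"
  unfolding dominated_def
proof (intro allI)
  fix \<alpha> \<beta>
  have "cmod (c \<alpha>) * (\<Prod>i\<in>UNIV. (sqrt (real (\<alpha> i)) / h') ^ \<beta> i)
      \<le> cmod (c \<alpha>) * (\<Prod>i\<in>UNIV. (sqrt (real (\<alpha> i)) / h) ^ \<beta> i)"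
    using assms(2,3) by (intro mult_left_mono prod_mono) (auto intro!: power_mono divide_left_mono)
  also have "\<dots> \<le> B * M \<beta>" using assms(1) by (auto simp: dominated_def)
  also have "\<dots> \<le> B * M' \<beta>" using assms(4,5) by (auto intro: mult_left_mono)
  finally show "cmod (c \<alpha>) * (\<Prod>i\<in>UNIV. (sqrt (real (\<alpha> i)) / h') ^ \<beta> i) \<le> B * M' \<beta>" .
qed

section \<open>Multipliers between step spaces\<close>

text \<open>The new indices and \<open>C\<close> are chosen before \<open>B\<close> and
  \<open>c\<close>: this is boundedness of the multiplication operator from one step space into
  another. Quantifying over all starting indices lets such operators be composed.\<close>

definition multiplier ::
  "(real \<Rightarrow> ('d::finite \<Rightarrow> nat) \<Rightarrow> real) \<Rightarrow> (('d \<Rightarrow> nat) \<Rightarrow> real) \<Rightarrow> bool" where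
  "multiplier M f \<longleftrightarrow>
     (\<forall>l>0. \<forall>h>0. \<exists>k>0. \<exists>h'>0. \<exists>C\<ge>0. \<forall>B\<ge>0. \<forall>c.
        dominated (M l) h B c \<longrightarrow> dominated (M k) h' (C * B) (\<lambda>\<alpha>. of_real (f \<alpha>) * c \<alpha>))"

lemma multiplierE:
  assumes "multiplier M f" and "0 < l" and "0 < h"
  obtains k h' C where "0 < k" "0 < h'" "0 \<le> C"
    "\<And>B c. 0 \<le> B \<Longrightarrow> dominated (M l) h B c \<Longrightarrow>
       dominated (M k) h' (C * B) (\<lambda>\<alpha>. of_real (f \<alpha>) * c \<alpha>)"
proof -
  obtain k h' C where "0 < k" "0 < h'" "0 \<le> C"
    and "\<forall>B\<ge>0. \<forall>c. dominated (M l) h B c \<longrightarrow>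
       dominated (M k) h' (C * B) (\<lambda>\<alpha>. of_real (f \<alpha>) * c \<alpha>)"
    using assms(1)[unfolded multiplier_def, rule_format, OF assms(2,3)] by (elim exE conjE)
  then show thesis by (intro that[of k h' C]) simp_all
qed

lemma multiplier_one: "multiplier M (\<lambda>_. 1)"
proof -
  have "\<forall>B\<ge>0. \<forall>c. dominated (M l) h B c \<longrightarrow> dominated (M l) h (1 * B) (\<lambda>\<alpha>. of_real 1 * c \<alpha>)"
    for l h by simp
  then show ?thesis unfolding multiplier_def using zero_le_one by blast
qed

lemma multiplier_mult:
  assumes "multiplier M f" and "multiplier M g"
  shows "multiplier M (\<lambda>\<alpha>. f \<alpha> * g \<alpha>)"
  unfolding multiplier_def
proof (intro allI impI)
  fix l h :: real assume lh: "0 < l" "0 < h"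
  obtain k h' C where k: "0 < k" "0 < h'" "0 \<le> C"
    and g: "\<And>B c. 0 \<le> B \<Longrightarrow> dominated (M l) h B c \<Longrightarrow>
              dominated (M k) h' (C * B) (\<lambda>\<alpha>. of_real (g \<alpha>) * c \<alpha>)"
    by (rule multiplierE[OF assms(2) lh]) blast
  obtain m h'' D where m: "0 < m" "0 < h''" "0 \<le> D"
    and f: "\<And>B c. 0 \<le> B \<Longrightarrow> dominated (M k) h' B c \<Longrightarrow>
              dominated (M m) h'' (D * B) (\<lambda>\<alpha>. of_real (f \<alpha>) * c \<alpha>)"
    by (rule multiplierE[OF assms(1) k(1,2)]) blast
  have "dominated (M m) h'' (D * C * B) (\<lambda>\<alpha>. of_real (f \<alpha> * g \<alpha>) * c \<alpha>)"
    if "0 \<le> B" "dominated (M l) h B c" for B c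
    using f[OF _ g[OF that]] that(1) k(3) by (simp add: mult.assoc)
  moreover have "0 \<le> D * C" using k m by simp
  ultimately show "\<exists>k>0. \<exists>h'>0. \<exists>C\<ge>0. \<forall>B\<ge>0. \<forall>c. dominated (M l) h B c \<longrightarrow>
      dominated (M k) h' (C * B) (\<lambda>\<alpha>. of_real (f \<alpha> * g \<alpha>) * c \<alpha>)"
    using m by blast
qed

lemma multiplier_power:
  assumes "multiplier M f"
  shows "multiplier M (\<lambda>\<alpha>. f \<alpha> ^ n)"
proof (induction n)
  case 0
  show ?case unfolding power_0 by (rule multiplier_one)
next
  case (Suc n)
  show ?case unfolding power_Suc by (rule multiplier_mult[OF assms Suc])
qed

lemma multiplier_prod:
  assumes "\<And>i. i \<in> I \<Longrightarrow> multiplier M (f i)"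
  shows "multiplier M (\<lambda>\<alpha>. \<Prod>i\<in>I. f i \<alpha>)"
  using assms
proof (induction I rule: infinite_finite_induct)
  case (insert i I)
  show ?case
    unfolding prod.insert[OF insert(1,2)] using insert by (intro multiplier_mult) blast+
qed (simp_all add: multiplier_one)

lemma prod_power_add_unitv:
  fixes t :: "'d::finite \<Rightarrow> real"
  shows "(\<Prod>i\<in>UNIV. t i ^ (\<beta> i + unitv j i)) = t j * (\<Prod>i\<in>UNIV. t i ^ \<beta> i)"
proof -
  have "(\<Prod>i\<in>UNIV. t i ^ unitv j i) = (\<Prod>i\<in>UNIV. if i = j then t i else 1)"
    by (intro prod.cong) (auto simp: unitv_def)
  then show ?thesis by (simp add: power_add prod.distrib mult.commute)
qed

text \<open>The hypothesis on the weight matrix is the transfer of one index step from \<open>M l\<close> to \<open>M k\<close>;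
  that step supplies the extra factor \<open>sqrt (\<alpha> j)\<close>, while \<open>A ^ mlen \<beta>\<close> is absorbed in \<open>h\<close>.\<close>

lemma multiplier_sqrt:
  fixes M :: "real \<Rightarrow> ('d::finite \<Rightarrow> nat) \<Rightarrow> real"
  assumes M: "weight_matrix M"
    and shift: "\<forall>l>0. \<exists>k\<ge>l. \<exists>A\<ge>1. \<forall>\<alpha> j.
           M l (\<lambda>i. \<alpha> i + unitv j i) \<le> A ^ (mlen \<alpha> + 1) * M k \<alpha>"
  shows "multiplier M (\<lambda>\<alpha>. sqrt (1 + real (\<alpha> j)))"
  unfolding multiplier_def
proof (intro allI impI)
  fix l h :: real assume l: "0 < l" and h: "0 < h"
  obtain k A where k: "l \<le> k" "1 \<le> A"
    and A: "\<And>\<alpha>. M l (\<lambda>i. \<alpha> i + unitv j i) \<le> A ^ (mlen \<alpha> + 1) * M k \<alpha>"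
    using shift l by meson
  \<comment> \<open>The entry 1 serves \<open>\<alpha> j = 0\<close>, where the factor is 1 and
    monotonicity in the weight and in \<open>h\<close> suffices. The other entry serves
    \<open>\<alpha> j \<ge> 1\<close>: \<open>sqrt 2\<close> replaces \<open>1 + \<alpha> j\<close>
    by \<open>\<alpha> j\<close>, \<open>h\<close> clears the denominator of the extra factor, and
    \<open>A\<close> is what remains of \<open>A ^ (mlen \<beta> + 1)\<close>.\<close>
  define C where "C = max 1 (sqrt 2 * h * A)"
  have Mk: "0 < M k \<beta>" "M l \<beta> \<le> M k \<beta>" for \<beta>
    using M l k by (auto simp: weight_matrix_def)
  have "dominated (M k) (A * h) (C * B) (\<lambda>\<alpha>. of_real (sqrt (1 + real (\<alpha> j))) * c \<alpha>)"
    if B: "0 \<le> B" and c: "dominated (M l) h B c" for B c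
    unfolding dominated_def
  proof (intro allI)
    fix \<alpha> \<beta> :: "'d \<Rightarrow> nat"
    define P where "P g = (\<Prod>i\<in>UNIV. (sqrt (real (\<alpha> i)) / g) ^ \<beta> i)" for g
    have P_nonneg: "0 \<le> P (A * h)" using k h by (auto simp: P_def intro!: prod_nonneg)
    have P_scale: "P h = A ^ mlen \<beta> * P (A * h)"
    proof -
      have "P h = (\<Prod>i\<in>UNIV. A ^ \<beta> i * (sqrt (real (\<alpha> i)) / (A * h)) ^ \<beta> i)"
        unfolding P_def using k by (intro prod.cong) (auto simp flip: power_mult_distrib)
      then show ?thesis by (simp add: prod.distrib P_def mlen_def power_sum)
    qed
    have "cmod (c \<alpha>) * (sqrt (1 + real (\<alpha> j)) * P (A * h)) \<le> C * B * M k \<beta>"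
    proof (cases "\<alpha> j = 0")
      case True
      have "cmod (c \<alpha>) * P (A * h) \<le> B * M k \<beta>"
      proof -
        have "dominated (M k) (A * h) B c"
          using c h B Mk k by (intro dominated_mono[OF c]) auto
        then show ?thesis by (auto simp: dominated_def P_def)
      qed
      also have "\<dots> \<le> C * (B * M k \<beta>)"
        using B Mk(1)[of \<beta>] mult_right_mono[of 1 C "B * M k \<beta>"] by (simp add: C_def)
      finally show ?thesis using True by (simp add: mult.assoc)
    next
      case False
      \<comment> \<open>Domination is used at the raised index, whose monomial carries one more
        factor \<open>sqrt (\<alpha> j) / h\<close>.\<close>
      have "cmod (c \<alpha>) * (sqrt (real (\<alpha> j)) / h * P h) \<le> B * M l (\<lambda>i. \<beta> i + unitv j i)"
        using c[unfolded dominated_def, rule_format, of \<alpha> "\<lambda>i. \<beta> i + unitv j i"]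
        by (simp add: prod_power_add_unitv P_def)
      also have "\<dots> \<le> B * (A ^ (mlen \<beta> + 1) * M k \<beta>)"
        using A B by (intro mult_left_mono)
      finally have "A ^ mlen \<beta> * (cmod (c \<alpha>) * (sqrt (real (\<alpha> j)) / h * P (A * h)))
          \<le> A ^ mlen \<beta> * (A * B * M k \<beta>)"
        by (simp add: P_scale mult_ac)
      then have "cmod (c \<alpha>) * (sqrt (real (\<alpha> j)) / h * P (A * h)) \<le> A * B * M k \<beta>"
        using k by (subst (asm) mult_le_cancel_left_pos) auto
      then have *: "cmod (c \<alpha>) * (sqrt (real (\<alpha> j)) * P (A * h)) \<le> h * A * B * M k \<beta>"
        using h by (simp add: field_simps)
      have "sqrt (1 + real (\<alpha> j)) \<le> sqrt 2 * sqrt (real (\<alpha> j))"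
        using False by (simp flip: real_sqrt_mult)
      then have "cmod (c \<alpha>) * (sqrt (1 + real (\<alpha> j)) * P (A * h))
          \<le> cmod (c \<alpha>) * (sqrt 2 * sqrt (real (\<alpha> j)) * P (A * h))"
        using P_nonneg by (intro mult_left_mono mult_right_mono) auto
      also have "\<dots> \<le> sqrt 2 * (h * A * B * M k \<beta>)"
        using mult_left_mono[OF *, of "sqrt 2"] by (simp add: mult_ac)
      also have "\<dots> \<le> C * (B * M k \<beta>)"
        using B Mk(1)[of \<beta>] mult_right_mono[of "sqrt 2 * h * A" C "B * M k \<beta>"]
        by (simp add: C_def mult_ac)
      finally show ?thesis by (simp add: mult.assoc)
    qed
    then show "cmod (of_real (sqrt (1 + real (\<alpha> j))) * c \<alpha>) *
        (\<Prod>i\<in>UNIV. (sqrt (real (\<alpha> i)) / (A * h)) ^ \<beta> i) \<le> C * B * M k \<beta>"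
      by (simp add: norm_mult P_def mult_ac)
  qed
  moreover have "0 < k" "0 < A * h" "0 \<le> C" using l k h by (auto simp: C_def)
  ultimately show "\<exists>k>0. \<exists>h'>0. \<exists>C\<ge>0. \<forall>B\<ge>0. \<forall>c. dominated (M l) h B c \<longrightarrow>
      dominated (M k) h' (C * B) (\<lambda>\<alpha>. of_real (sqrt (1 + real (\<alpha> j))) * c \<alpha>)"
    by blast
qed

section \<open>A summable weight whose inverse is a multiplier\<close>

definition decay :: "('d::finite \<Rightarrow> nat) \<Rightarrow> real" where
  "decay \<alpha> = (\<Prod>i\<in>UNIV. 1 / (1 + real (\<alpha> i)) ^ 2)"

lemma decay_pos: "0 < decay \<alpha>"
  unfolding decay_def by (intro prod_pos) (auto intro!: zero_less_power)

lemma decay_le_1: "decay \<alpha> \<le> 1"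
  unfolding decay_def by (intro prod_le_1) (auto simp: divide_le_eq)

text \<open>Each factor \<open>(1 + \<alpha> j)^2\<close> of the inverse is the fourth power of
  \<open>sqrt (1 + \<alpha> j)\<close>, so only finitely many multiplications are involved.\<close>

lemma multiplier_inverse_decay:
  assumes "\<And>j. multiplier M (\<lambda>\<alpha>. sqrt (1 + real (\<alpha> j)))"
  shows "multiplier M (\<lambda>\<alpha>. 1 / decay \<alpha>)"
proof -
  have "sqrt x ^ 4 = x ^ 2" if "0 \<le> x" for x
    using that by (metis (no_types) mult_2 numeral_Bit0 power2_eq_square power_add real_sqrt_pow2)
  then have eq: "(\<lambda>\<alpha>. 1 / decay \<alpha>) = (\<lambda>\<alpha>. \<Prod>j\<in>UNIV. sqrt (1 + real (\<alpha> j)) ^ 4)"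
    by (auto simp: decay_def prod_dividef)
  show ?thesis
    unfolding eq by (intro multiplier_prod multiplier_power assms)
qed

text \<open>Any finite set of multi-indices lies in a box, and the sum of the product weight over a
  box factors into one-dimensional sums of \<open>1 / (1 + k)^2\<close>, bounded independently of
  the box.\<close>

lemma summable_decay_enumeration:
  fixes e :: "nat \<Rightarrow> ('d::finite \<Rightarrow> nat)"
  assumes "inj e"
  shows "summable (\<lambda>n. decay (e n))"
proof (rule summableI_nonneg_bounded)
  define s :: "nat \<Rightarrow> real" where "s k = 1 / (1 + real k) ^ 2" for k
  have "summable s"
    using inverse_power_summable[of 2, where 'a=real]
      summable_Suc_iff[of "\<lambda>n. inverse (real n ^ 2)"]
    by (simp add: s_def[abs_def] inverse_eq_divide add.commute)
  have s_nonneg: "0 \<le> s k" for k by (simp add: s_def)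
  show "(\<Sum>n<N. decay (e n)) \<le> suminf s ^ CARD('d)" for N
  proof -
    \<comment> \<open>A crude side length: the sum of all lengths bounds every coordinate of the
      first \<open>N\<close> multi-indices.\<close>
    define K where "K = Suc (\<Sum>n<N. mlen (e n))"
    have "e n i < K" if "n < N" for n i
    proof -
      have "e n i \<le> mlen (e n)" by (auto simp: mlen_def intro!: member_le_sum)
      also have "\<dots> \<le> (\<Sum>n<N. mlen (e n))" using that by (auto intro!: member_le_sum)
      finally show ?thesis by (simp add: K_def)
    qed
    then have sub: "e ` {..<N} \<subseteq> PiE UNIV (\<lambda>_. {..<K})" by auto
    have "(\<Sum>n<N. decay (e n)) = sum decay (e ` {..<N})"
      using assms by (subst sum.reindex) (auto intro: inj_on_subset)
    also have "\<dots> \<le> sum decay (PiE (UNIV :: 'd set) (\<lambda>_. {..<K}))"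
      by (rule sum_mono2[OF _ sub]) (auto simp: finite_PiE decay_pos less_imp_le)
    also have "\<dots> = (\<Prod>i\<in>(UNIV::'d set). \<Sum>k<K. s k)"
      by (subst prod_sum_PiE) (auto simp: decay_def s_def)
    also have "\<dots> = (\<Sum>k<K. s k) ^ CARD('d)" by simp
    also have "\<dots> \<le> suminf s ^ CARD('d)"
      using \<open>summable s\<close> s_nonneg by (intro power_mono sum_le_suminf sum_nonneg) auto
    finally show ?thesis .
  qed
qed (simp add: decay_pos less_imp_le)


section \<open>The sequence space through its integer steps, coordinate vectors and continuous
  seminorms\<close>

definition delta :: "'i \<Rightarrow> 'i \<Rightarrow> complex" where
  "delta a = (\<lambda>i. if i = a then 1 else 0)"

context
  fixes M :: "real \<Rightarrow> ('d::finite \<Rightarrow> nat) \<Rightarrow> real"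
  assumes M: "weight_matrix M"
begin

lemma weight_pos: "0 < l \<Longrightarrow> 0 < M l \<alpha>"
  using M unfolding weight_matrix_def by blast

lemma weight_mono: "0 < l \<Longrightarrow> l \<le> k \<Longrightarrow> M l \<alpha> \<le> M k \<alpha>"
  using M unfolding weight_matrix_def by blast

lemma seqnorm_finite_imp_dominated:
  assumes "0 < l" "0 < h" "seqnorm (M l) h c < \<infinity>"
  shows "dominated (M l) h (real_of_ereal (seqnorm (M l) h c)) c"
proof -
  have "\<bar>seqnorm (M l) h c\<bar> \<noteq> \<infinity>" using seqnorm_nonneg[of "M l" h c] assms(3) by auto
  then show ?thesis
    using seqnorm_nonneg[of "M l" h c] assms
    by (subst seqnorm_le_iff_dominated[symmetric])
       (auto simp: weight_pos ereal_real real_of_ereal_pos)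
qed

lemma dominated_imp_seqnorm_le:
  assumes "0 < l" "0 < h" "0 \<le> B" "dominated (M l) h B c"
  shows "seqnorm (M l) h c \<le> ereal B"
  using assms by (subst seqnorm_le_iff_dominated) (auto simp: weight_pos)

text \<open>The diagonal steps are cofinal: an integer above both \<open>l\<close> and
  \<open>h\<close> enlarges the weight sequence and shrinks the monomials.\<close>

lemma dominated_nat_index:
  assumes "0 < l" "0 < h"
  obtains j :: nat where "1 \<le> j"
    "\<And>B c. 0 \<le> B \<Longrightarrow> dominated (M l) h B c \<Longrightarrow> dominated (M (real j)) (real j) B c"
proof
  define j where "j = nat \<lceil>max l h\<rceil>"
  have j: "l \<le> real j" "h \<le> real j" unfolding j_def by linarith+
  then show "1 \<le> j" using assms by linarith
  show "dominated (M (real j)) (real j) B c" if "0 \<le> B" "dominated (M l) h B c" for B c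
    using that j assms by (intro dominated_mono[OF that(2)]) (auto intro: weight_mono)
qed

lemma mem_Lambda_M_iff_dominated:
  "c \<in> Lambda_M M \<longleftrightarrow> (\<exists>j\<ge>1. \<exists>B\<ge>0. dominated (M (real j)) (real j) B c)"
proof
  assume "c \<in> Lambda_M M"
  then obtain l h where lh: "0 < l" "0 < h" "seqnorm (M l) h c < \<infinity>"
    by (auto simp: Lambda_M_def)
  obtain j :: nat where "1 \<le> j"
    "\<And>B c. 0 \<le> B \<Longrightarrow> dominated (M l) h B c \<Longrightarrow> dominated (M (real j)) (real j) B c"
    using dominated_nat_index lh by metis
  then show "\<exists>j\<ge>1. \<exists>B\<ge>0. dominated (M (real j)) (real j) B c"
    using seqnorm_finite_imp_dominated[OF lh] seqnorm_nonneg real_of_ereal_pos by blast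
next
  assume "\<exists>j\<ge>1. \<exists>B\<ge>0. dominated (M (real j)) (real j) B c"
  then obtain j B where "1 \<le> j" "0 \<le> B" "dominated (M (real j)) (real j) B c" by blast
  then have "seqnorm (M (real j)) (real j) c \<le> ereal B" "0 < real j"
    by (auto intro: dominated_imp_seqnorm_le)
  then show "c \<in> Lambda_M M"
    unfolding Lambda_M_def by (auto intro!: exI[of _ "real j"] elim: le_less_trans)
qed

text \<open>The space is solid, which puts truncations, remainders and single coordinates of its
  members back into it.\<close>

lemma Lambda_M_cmod_le:
  assumes "c \<in> Lambda_M M" "\<And>\<alpha>. cmod (c' \<alpha>) \<le> cmod (c \<alpha>)"
  shows "c' \<in> Lambda_M M"
proof -
  obtain j B where "1 \<le> j" "0 \<le> B" "dominated (M (real j)) (real j) B c"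
    using assms(1) by (auto simp: mem_Lambda_M_iff_dominated)
  moreover from this have "dominated (M (real j)) (real j) B c'"
    by (intro dominated_cmod_le[OF _ _ assms(2)]) simp_all
  ultimately show ?thesis unfolding mem_Lambda_M_iff_dominated by blast
qed

lemma Lambda_M_scale:
  assumes "c \<in> Lambda_M M"
  shows "(\<lambda>\<alpha>. a * c \<alpha>) \<in> Lambda_M M"
proof -
  obtain j B where j: "1 \<le> j" "0 \<le> B" "dominated (M (real j)) (real j) B c"
    using assms by (auto simp: mem_Lambda_M_iff_dominated)
  then have "dominated (M (real j)) (real j) (cmod a * B) (\<lambda>\<alpha>. a * c \<alpha>)"
    by (intro dominated_cmod_le[OF dominated_scale]) (auto simp: norm_mult)
  then show ?thesis using j unfolding mem_Lambda_M_iff_dominated by (metis mult_nonneg_nonneg norm_ge_zero)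
qed

text \<open>The weight at \<open>\<alpha>\<close> can be infinite for all parameters, so membership
  is not automatic. Conversely, if \<open>delta \<alpha>\<close> lies outside the space, every
  member vanishes at \<open>\<alpha>\<close>.\<close>

lemma delta_in_Lambda_M:
  assumes "c \<in> Lambda_M M" "c \<alpha> \<noteq> 0"
  shows "delta \<alpha> \<in> Lambda_M M"
  by (rule Lambda_M_cmod_le[OF Lambda_M_scale[OF assms(1), of "1 / c \<alpha>"]])
     (use assms(2) in \<open>auto simp: delta_def\<close>)

lemma multiplier_nat_index:
  assumes "multiplier M f" "1 \<le> (j::nat)"
  obtains k :: nat and C where "1 \<le> k" "0 \<le> C"
    "\<And>B c. 0 \<le> B \<Longrightarrow> dominated (M (real j)) (real j) B c \<Longrightarrow>
       dominated (M (real k)) (real k) (C * B) (\<lambda>\<alpha>. of_real (f \<alpha>) * c \<alpha>)"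
proof -
  have j: "0 < real j" using assms(2) by simp
  obtain l h C where lh: "0 < l" "0 < h" "0 \<le> C"
    and f: "\<And>B c. 0 \<le> B \<Longrightarrow> dominated (M (real j)) (real j) B c \<Longrightarrow>
       dominated (M l) h (C * B) (\<lambda>\<alpha>. of_real (f \<alpha>) * c \<alpha>)"
    by (rule multiplierE[OF assms(1) j j]) blast
  obtain k :: nat where "1 \<le> k"
    "\<And>B c. 0 \<le> B \<Longrightarrow> dominated (M l) h B c \<Longrightarrow> dominated (M (real k)) (real k) B c"
    using dominated_nat_index lh by metis
  then show thesis using that[of k C] f lh(3) by simp
qed

lemma cont_seminorm_dominated:
  assumes "cont_seminorm_Lambda M p" "1 \<le> (j::nat)"
  obtains C where "0 \<le> C"
    "\<And>B c. 0 \<le> B \<Longrightarrow> dominated (M (real j)) (real j) B c \<Longrightarrow> p c \<le> C * B"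
proof -
  obtain C where C: "\<And>c. c \<in> step_space M j \<Longrightarrow>
      p c \<le> C * real_of_ereal (seqnorm (M (real j)) (real j) c)"
    using assms unfolding cont_seminorm_Lambda_def by meson
  \<comment> \<open>The constant given by continuity may be negative; raising it to at least 0
    allows replacing the step norm by its upper bound \<open>B\<close>.\<close>
  have "p c \<le> max C 0 * B" if B: "0 \<le> B" and c: "dominated (M (real j)) (real j) B c" for B c
  proof -
    let ?n = "seqnorm (M (real j)) (real j) c"
    have le: "?n \<le> ereal B" using assms(2) B c by (intro dominated_imp_seqnorm_le) auto
    then have "c \<in> step_space M j" by (auto simp: step_space_def)
    then have "p c \<le> C * real_of_ereal ?n" by (rule C)
    also have "\<dots> \<le> max C 0 * real_of_ereal ?n"
      by (intro mult_right_mono) (auto simp: seqnorm_nonneg real_of_ereal_pos)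
    also have "\<dots> \<le> max C 0 * B"
      using le seqnorm_nonneg[of "M (real j)" "real j" c] B
      by (intro mult_left_mono) (auto intro: real_of_ereal_positive_mono[of _ "ereal B", simplified])
    finally show ?thesis .
  qed
  then show thesis using that[of "max C 0"] by auto
qed

end

section \<open>The dominating weighted l1 seminorm\<close>

theorem theorem5p4:
  fixes M :: "real \<Rightarrow> ('d::finite \<Rightarrow> nat) \<Rightarrow> real"
  assumes "weight_matrix M"
    and "\<forall>l>0. \<exists>k\<ge>l. \<exists>A\<ge>1. \<forall>\<alpha> j.
           M l (\<lambda>i. \<alpha> i + unitv j i) \<le> A ^ (mlen \<alpha> + 1) * M k \<alpha>"
  shows "nuclear_lcs (Lambda_M M) (cont_seminorm_Lambda M)"
  unfolding nuclear_lcs_def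
proof (intro allI impI)
  fix p assume p: "cont_seminorm_Lambda M p"
  note M = assms(1)
  let ?E = "Lambda_M M"
  have mult: "multiplier M (\<lambda>\<alpha>. 1 / decay \<alpha>)"
    using multiplier_sqrt[OF assms] by (rule multiplier_inverse_decay)
  have p_nonneg: "\<And>x. x \<in> ?E \<Longrightarrow> 0 \<le> p x"
    and p_add: "\<And>x y. x \<in> ?E \<Longrightarrow> y \<in> ?E \<Longrightarrow> p (\<lambda>i. x i + y i) \<le> p x + p y"
    and p_scale: "\<And>x a. x \<in> ?E \<Longrightarrow> p (\<lambda>i. a * x i) = cmod a * p x"
    using p by (auto simp: cont_seminorm_Lambda_def seminorm_on_def)

  have "infinite (UNIV :: ('d \<Rightarrow> nat) set)"
    by (metis finite_fun_UNIVD2 infinite_UNIV_nat)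
  then have e_bij: "bij (from_nat_into (UNIV :: ('d \<Rightarrow> nat) set))"
    by (intro bij_betw_from_nat_into) auto
  define e :: "nat \<Rightarrow> 'd \<Rightarrow> nat" where "e = from_nat_into UNIV"
  have e: "inj e" "surj e" using e_bij by (auto simp: e_def bij_def)
  have decay_e: "summable (\<lambda>n. decay (e n))" using e(1) by (rule summable_decay_enumeration)

  \<comment> \<open>\<open>p\<close> is controlled only on the space, hence the default 0 for
    coordinate vectors outside it. The summand 1 keeps \<open>w\<close> positive, so that coordinate
    vectors can be normalised by it.\<close>
  define w where "w \<alpha> = 1 + (if delta \<alpha> \<in> ?E then p (delta \<alpha>) else 0)" for \<alpha>
  have w_ge_1: "1 \<le> w \<alpha>" for \<alpha> by (simp add: w_def p_nonneg)
  define q where "q x = (\<Sum>n. cmod (x (e n)) * (w (e n) / decay (e n)))" for x :: "('d \<Rightarrow> nat) \<Rightarrow> complex"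

  \<comment> \<open>Two factors \<open>1 / decay\<close> are gained: one pays for the weight in
    \<open>q\<close>, the other leaves \<open>decay \<alpha>\<close> on the right and makes the
    series converge. As \<open>D\<close> precedes \<open>B\<close> and \<open>x\<close>, the bound
    also gives continuity of \<open>q\<close> on each step.\<close>
  have w_bound: "\<exists>D\<ge>0. \<forall>B\<ge>0. \<forall>x. dominated (M (real j)) (real j) B x \<longrightarrow>
      (\<forall>\<alpha>. cmod (x \<alpha>) * (w \<alpha> / decay \<alpha>) \<le> D * B * decay \<alpha>)" if j: "1 \<le> j" for j :: nat
  proof -
    obtain k C where k: "1 \<le> k" "0 \<le> C"
      and dom: "\<And>B c. 0 \<le> B \<Longrightarrow> dominated (M (real j)) (real j) B c \<Longrightarrow>
        dominated (M (real k)) (real k) (C * B) (\<lambda>\<alpha>. of_real (1 / decay \<alpha> * (1 / decay \<alpha>)) * c \<alpha>)"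
      by (rule multiplier_nat_index[OF M multiplier_mult[OF mult mult] j]) blast
    obtain C' where C': "0 \<le> C'"
      and p_le: "\<And>B c. 0 \<le> B \<Longrightarrow> dominated (M (real k)) (real k) B c \<Longrightarrow> p c \<le> C' * B"
      by (rule cont_seminorm_dominated[OF M p k(1)]) blast
    \<comment> \<open>In the constant, \<open>C\<close> accounts for the summand 1 of
      \<open>w \<alpha>\<close> and \<open>C' * C\<close> for
      \<open>p (delta \<alpha>)\<close>.\<close>
    have "cmod (x \<alpha>) * (w \<alpha> / decay \<alpha>) \<le> (C + C' * C) * B * decay \<alpha>"
      if B: "0 \<le> B" and x: "dominated (M (real j)) (real j) B x" for B x \<alpha>
    proof (cases "x \<alpha> = 0")
      case True
      then show ?thesis using B k C' decay_pos[of \<alpha>] by simp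
    next
      case False
      define z where "z = of_real (1 / decay \<alpha> * (1 / decay \<alpha>)) * x \<alpha>"
      have z: "cmod z = cmod (x \<alpha>) / decay \<alpha> / decay \<alpha>"
        using decay_pos[of \<alpha>] by (simp add: z_def norm_mult norm_divide)
      have "x \<in> ?E" using x B j by (auto simp: mem_Lambda_M_iff_dominated[OF M])
      then have delta: "delta \<alpha> \<in> ?E" using False by (rule delta_in_Lambda_M[OF M])
      \<comment> \<open>Domination at the index zero, where the monomial and the weight are both
        1.\<close>
      have "cmod z \<le> C * B"
        using dom[OF B x, unfolded dominated_def, rule_format, of \<alpha> "\<lambda>_. 0"] M k(1)
        by (simp add: z_def weight_matrix_def)
      moreover have "cmod z * p (delta \<alpha>) \<le> C' * (C * B)"
      proof -
        \<comment> \<open>This vector is the \<open>\<alpha>\<close> coordinate of the multiplied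
          sequence, so it inherits the domination.\<close>
        have "dominated (M (real k)) (real k) (C * B) (\<lambda>i. z * delta \<alpha> i)"
          using dom[OF B x] by (rule dominated_cmod_le) (use k(1) in \<open>auto simp: z_def delta_def\<close>)
        then have "p (\<lambda>i. z * delta \<alpha> i) \<le> C' * (C * B)" using k B by (intro p_le) auto
        then show ?thesis by (simp add: p_scale[OF delta])
      qed
      ultimately have "cmod z * w \<alpha> \<le> (C + C' * C) * B"
        using delta by (simp add: w_def algebra_simps)
      then show ?thesis
        using decay_pos[of \<alpha>] by (simp add: z field_simps)
    qed
    then show ?thesis using k C' by (intro exI[of _ "C + C' * C"]) auto
  qed

  have term_nonneg: "0 \<le> cmod (x (e n)) * (w (e n) / decay (e n))" for x n
    using w_ge_1[of "e n"] decay_pos[of "e n"] by simp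
  have q_bound: "summable (\<lambda>n. cmod (x (e n)) * (w (e n) / decay (e n)))"
      "q x \<le> D * B * (\<Sum>n. decay (e n))"
    if "\<And>\<alpha>. cmod (x \<alpha>) * (w \<alpha> / decay \<alpha>) \<le> D * B * decay \<alpha>" for D B x
  proof -
    show *: "summable (\<lambda>n. cmod (x (e n)) * (w (e n) / decay (e n)))"
      using that term_nonneg[of x]
      by (intro summable_comparison_test'[OF summable_mult[OF decay_e, of "D * B"], of 0])
         (simp only: real_norm_def abs_of_nonneg)
    show "q x \<le> D * B * (\<Sum>n. decay (e n))"
      unfolding q_def suminf_mult[OF decay_e, symmetric]
      using that by (intro suminf_le * summable_mult decay_e)
  qed
  have q_summable: "summable (\<lambda>n. cmod (x (e n)) * (w (e n) / decay (e n)))" if "x \<in> ?E" for x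
  proof -
    obtain j B where "1 \<le> j" "0 \<le> B" "dominated (M (real j)) (real j) B x"
      using \<open>x \<in> ?E\<close> by (auto simp: mem_Lambda_M_iff_dominated[OF M])
    then show ?thesis using q_bound(1) w_bound by blast
  qed

  have "seminorm_on ?E q"
    unfolding seminorm_on_def
  proof (intro conjI ballI allI)
    fix x assume x: "x \<in> ?E"
    show "0 \<le> q x" unfolding q_def by (intro suminf_nonneg q_summable x term_nonneg)
    show "q (\<lambda>i. a * x i) = cmod a * q x" for a
      unfolding q_def by (subst suminf_mult[OF q_summable[OF x], symmetric]) (simp add: norm_mult mult.assoc)
    fix y assume y: "y \<in> ?E"
    have le: "cmod (x (e n) + y (e n)) * (w (e n) / decay (e n))
        \<le> cmod (x (e n)) * (w (e n) / decay (e n)) + cmod (y (e n)) * (w (e n) / decay (e n))" for n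
      using w_ge_1[of "e n"] decay_pos[of "e n"]
      by (subst distrib_right[symmetric]) (intro mult_right_mono norm_triangle_ineq, simp)
    have sm: "summable (\<lambda>n. cmod (x (e n)) * (w (e n) / decay (e n)) + cmod (y (e n)) * (w (e n) / decay (e n)))"
      by (intro summable_add q_summable x y)
    have "summable (\<lambda>n. cmod (x (e n) + y (e n)) * (w (e n) / decay (e n)))"
      using le term_nonneg[of "\<lambda>i. x i + y i"]
      by (intro summable_comparison_test'[OF sm, of 0]) (simp only: real_norm_def abs_of_nonneg)
    then show "q (\<lambda>i. x i + y i) \<le> q x + q y"
      unfolding q_def suminf_add[OF q_summable[OF x] q_summable[OF y]]
      by (intro suminf_le le sm)
  qed
  moreover have "\<exists>C. \<forall>c\<in>step_space M j. q c \<le> C * real_of_ereal (seqnorm (M (real j)) (real j) c)"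
    if j: "1 \<le> j" for j
  proof -
    obtain D where D: "\<And>B x \<alpha>. 0 \<le> B \<Longrightarrow> dominated (M (real j)) (real j) B x \<Longrightarrow>
        cmod (x \<alpha>) * (w \<alpha> / decay \<alpha>) \<le> D * B * decay \<alpha>"
      using w_bound[OF j] by blast
    have "q c \<le> D * (\<Sum>n. decay (e n)) * real_of_ereal (seqnorm (M (real j)) (real j) c)"
      if "c \<in> step_space M j" for c
    proof -
      have "dominated (M (real j)) (real j) (real_of_ereal (seqnorm (M (real j)) (real j) c)) c"
        using that j by (intro seqnorm_finite_imp_dominated[OF M]) (auto simp: step_space_def)
      from q_bound(2)[OF D[OF _ this]] show ?thesis
        by (simp add: seqnorm_nonneg real_of_ereal_pos mult_ac)
    qed
    then show ?thesis by blast
  qed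
  ultimately have q: "cont_seminorm_Lambda M q" by (simp add: cont_seminorm_Lambda_def)

  \<comment> \<open>Truncations along the enumeration and convergence of the expansion\<close>
  define T where "T N x = (\<lambda>\<alpha>. if \<alpha> \<in> e ` {..<N} then x \<alpha> else 0)" for N and x :: "('d \<Rightarrow> nat) \<Rightarrow> complex"
  have T_in: "T N x \<in> ?E" and diff_in: "(\<lambda>i. x i - T N x i) \<in> ?E" if "x \<in> ?E" for N x
    by (rule Lambda_M_cmod_le[OF M that], simp add: T_def)+
  \<comment> \<open>Off the first \<open>N\<close> multi-indices
    \<open>decay \<alpha> \<le> r N\<close>, so the remainder is at most \<open>r N\<close> times
    \<open>x / decay\<close> coordinatewise. The latter is dominated in one fixed step, where
    \<open>p\<close> is bounded, and \<open>r N\<close> tends to 0.\<close>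
  have tail: "(\<lambda>N. p (\<lambda>i. x i - T N x i)) \<longlonglongrightarrow> 0" if x: "x \<in> ?E" for x
  proof -
    obtain j B where j: "1 \<le> j" and B: "0 \<le> B" "dominated (M (real j)) (real j) B x"
      using x by (auto simp: mem_Lambda_M_iff_dominated[OF M])
    obtain k C where k: "1 \<le> k" "0 \<le> C"
      and dom: "\<And>B c. 0 \<le> B \<Longrightarrow> dominated (M (real j)) (real j) B c \<Longrightarrow>
        dominated (M (real k)) (real k) (C * B) (\<lambda>\<alpha>. of_real (1 / decay \<alpha>) * c \<alpha>)"
      by (rule multiplier_nat_index[OF M mult j]) blast
    obtain C' where C': "0 \<le> C'"
      and p_le: "\<And>B c. 0 \<le> B \<Longrightarrow> dominated (M (real k)) (real k) B c \<Longrightarrow> p c \<le> C' * B"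
      by (rule cont_seminorm_dominated[OF M p k(1)]) blast
    \<comment> \<open>The remainder of a series of positive terms dominates each of its terms, and
      it tends to 0.\<close>
    define r where "r N = (\<Sum>n. decay (e n)) - (\<Sum>n<N. decay (e n))" for N
    have r_lim: "r \<longlonglongrightarrow> 0"
      using tendsto_diff[OF tendsto_const[of "\<Sum>n. decay (e n)"] summable_LIMSEQ[OF decay_e]]
      by (simp add: r_def[abs_def])
    have r_ge: "decay (e n) \<le> r N" if "N \<le> n" for n N
    proof -
      have "(\<Sum>m<N. decay (e m)) + decay (e n) = sum (\<lambda>m. decay (e m)) (insert n {..<N})"
        using that by simp
      also have "\<dots> \<le> (\<Sum>m. decay (e m))"
        by (intro sum_le_suminf decay_e) (auto simp: decay_pos less_imp_le)
      finally show ?thesis by (simp add: r_def)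
    qed
    have r_nonneg: "0 \<le> r N" for N using r_ge[of N N] decay_pos[of "e N"] by linarith
    have p_tail: "p (\<lambda>i. x i - T N x i) \<le> C' * (r N * (C * B))" for N
    proof (rule p_le)
      show "0 \<le> r N * (C * B)" using r_nonneg k B by simp
      show "dominated (M (real k)) (real k) (r N * (C * B)) (\<lambda>i. x i - T N x i)"
      proof (rule dominated_cmod_le[OF dominated_scale[OF dom[OF B] r_nonneg]])
        fix \<alpha>
        show "cmod (x \<alpha> - T N x \<alpha>) \<le> cmod (of_real (r N) * (of_real (1 / decay \<alpha>) * x \<alpha>))"
        proof (cases "\<alpha> \<in> e ` {..<N}")
          case False
          obtain n where n: "\<alpha> = e n" using e(2) by (metis surjD)
          then have "decay \<alpha> \<le> r N" using r_ge False by (metis imageI lessThan_iff not_le)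
          then have "1 \<le> r N / decay \<alpha>" using decay_pos[of \<alpha>] by simp
          then have "1 * cmod (x \<alpha>) \<le> r N / decay \<alpha> * cmod (x \<alpha>)"
            by (intro mult_right_mono) auto
          then show ?thesis
            using False r_nonneg[of N] decay_pos[of \<alpha>] by (simp add: T_def norm_mult norm_divide)
        qed (simp add: T_def)
      qed (use k in simp)
    qed
    have lim: "(\<lambda>N. C' * (r N * (C * B))) \<longlonglongrightarrow> 0"
      by (intro tendsto_mult_right_zero tendsto_mult_left_zero r_lim)
    show ?thesis
      by (rule tendsto_sandwich[OF always_eventually always_eventually tendsto_const lim])
         (intro allI p_nonneg diff_in x p_tail)+
  qed

  have T_Suc: "T (Suc N) x = (\<lambda>i. T N x i + x (e N) * delta (e N) i)" for N x
    by (rule ext) (auto simp: T_def delta_def inj_eq[OF e(1)] lessThan_Suc)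
  have p_term: "p (\<lambda>i. x (e N) * delta (e N) i) \<le> cmod (x (e N)) * (w (e N) / decay (e N))"
    and term_in: "(\<lambda>i. x (e N) * delta (e N) i) \<in> ?E" if x: "x \<in> ?E" for x N
  proof -
    show in_E: "(\<lambda>i. x (e N) * delta (e N) i) \<in> ?E"
      by (rule Lambda_M_cmod_le[OF M x]) (auto simp: delta_def)
    show "p (\<lambda>i. x (e N) * delta (e N) i) \<le> cmod (x (e N)) * (w (e N) / decay (e N))"
    proof (cases "x (e N) = 0")
      case True
      then show ?thesis using p_scale[OF x, of 0] by simp
    next
      case False
      then have d: "delta (e N) \<in> ?E" using delta_in_Lambda_M[OF M x] by simp
      then have "p (delta (e N)) \<le> w (e N)" by (simp add: w_def)
      also have "\<dots> \<le> w (e N) / decay (e N)"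
        using decay_pos[of "e N"] decay_le_1[of "e N"] w_ge_1[of "e N"]
        by (simp add: le_divide_eq mult_left_le)
      finally show ?thesis unfolding p_scale[OF d] by (intro mult_left_mono) auto
    qed
  qed
  have p_T: "p (T N x) \<le> q x" if x: "x \<in> ?E" for N x
  proof -
    have "p (T N x) \<le> (\<Sum>n<N. cmod (x (e n)) * (w (e n) / decay (e n)))"
    proof (induction N)
      case 0
      show ?case using p_scale[OF x, of 0] by (simp add: T_def)
    next
      case (Suc N)
      have "p (T (Suc N) x) \<le> p (T N x) + p (\<lambda>i. x (e N) * delta (e N) i)"
        unfolding T_Suc by (rule p_add[OF T_in[OF x] term_in[OF x]])
      then show ?case using Suc p_term[OF x, of N] by simp
    qed
    also have "\<dots> \<le> q x"
      unfolding q_def by (intro sum_le_suminf q_summable x term_nonneg) simp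
    finally show ?thesis .
  qed
  have p_le_q: "p x \<le> q x" if x: "x \<in> ?E" for x
  proof -
    \<comment> \<open>The truncations satisfy the estimate uniformly in \<open>N\<close>; letting
      \<open>N\<close> grow removes the remainder.\<close>
    have "p x \<le> p (\<lambda>i. x i - T N x i) + q x" for N
      using p_add[OF diff_in[OF x] T_in[OF x], of N N] p_T[OF x, of N] by simp
    then have "p x \<le> 0 + q x"
      by (intro LIMSEQ_le_const[OF tendsto_add[OF tail[OF x] tendsto_const]]) blast
    then show ?thesis by simp
  qed

  \<comment> \<open>The nuclear representation\<close>
  have "nuclear_canonical ?E p q"
    unfolding nuclear_canonical_def
  proof (intro exI conjI allI ballI)
    \<comment> \<open>Moving \<open>w\<close> from the coordinate vector to the functional gives
      \<open>p (y n) \<le> 1\<close>, while the division by \<open>decay\<close> in \<open>q\<close>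
      supplies the summable coefficients \<open>decay (e n)\<close>.\<close>
    define u where "u n x = of_real (w (e n)) * x (e n)" for n and x :: "('d \<Rightarrow> nat) \<Rightarrow> complex"
    define y where "y n = (if delta (e n) \<in> ?E then (\<lambda>i. of_real (1 / w (e n)) * delta (e n) i) else (\<lambda>_. 0))" for n
    have zero: "(\<lambda>_. 0) \<in> ?E" "p (\<lambda>_. 0) = 0"
    proof -
      show "(\<lambda>_. 0) \<in> ?E"
        by (auto simp: mem_Lambda_M_iff_dominated[OF M] dominated_def less_imp_le weight_pos[OF M]
            intro!: exI[of _ 1])
      then show "p (\<lambda>_. 0) = 0" using p_scale[of "\<lambda>_. 0" 0] by simp
    qed
    fix n
    show "linear_functional_on ?E (u n)"
      by (simp add: linear_functional_on_def u_def algebra_simps)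
    show "0 \<le> decay (e n)" by (simp add: decay_pos less_imp_le)
    show "summable (\<lambda>n. decay (e n))" by (rule decay_e)
    show "y n \<in> ?E"
      by (cases "delta (e n) \<in> ?E")
         (simp_all only: y_def if_True if_False zero Lambda_M_scale[OF M] not_False_eq_True)
    show "p (y n) \<le> 1"
    proof (cases "delta (e n) \<in> ?E")
      case True
      then have "p (y n) = cmod (of_real (1 / w (e n))) * p (delta (e n))"
        unfolding y_def by (simp only: if_True p_scale)
      also have "\<dots> = p (delta (e n)) / w (e n)"
        unfolding norm_of_real using w_ge_1[of "e n"] by simp
      also have "\<dots> \<le> 1" using True w_ge_1[of "e n"] by (simp add: w_def)
      finally show ?thesis .
    qed (simp add: y_def zero)
    fix x assume x: "x \<in> ?E"
    have "cmod (x (e n)) * (w (e n) / decay (e n)) \<le> q x"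
      unfolding q_def using sum_le_suminf[OF q_summable[OF x], of "{n}", OF _ term_nonneg[of x]] by simp
    then show "cmod (u n x) \<le> decay (e n) * q x"
      using w_ge_1[of "e n"] decay_pos[of "e n"] by (simp add: u_def norm_mult field_simps)
    \<comment> \<open>When \<open>y n\<close> takes its default zero, the coordinate
      \<open>x (e n)\<close> vanishes as well, so no term of the expansion is lost.\<close>
    have uy: "u n x * y n i = x (e n) * delta (e n) i" for n i
      using w_ge_1[of "e n"] delta_in_Lambda_M[OF M x, of "e n"] by (auto simp: u_def y_def)
    have "(\<Sum>n<N. u n x * y n i) = T N x i" for N i
      by (induction N) (auto simp: uy T_Suc, simp add: T_def)
    then show "(\<lambda>N. p (\<lambda>i. x i - (\<Sum>n<N. u n x * y n i))) \<longlonglongrightarrow> 0"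
      using tail[OF x] by simp
  qed
  then show "\<exists>q. cont_seminorm_Lambda M q \<and> (\<forall>x\<in>?E. p x \<le> q x) \<and> nuclear_canonical ?E p q"
    using q p_le_q by blast
qed

end
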